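(* Let $x\in F_1$, let $\Gamma_1:=\mathrm{supp}(x)$ and let $\gamma_x:=\min\Gamma_1$. Then the Bouligand tangent cone of $F_1$ at $x$ is $$T^B_{F_1}(x)=\{d\in\mathbb{R}^m:\ \|d\|_0\le s-1;\ d_j=0\ \forall j\le\gamma_x;\ x+\mu d\in F_1\ \forall\mu\in\mathbb{R}\}$$ $$=\bigcup_{\Lambda}\mathrm{span}\{e_i:\ i\in\Lambda\},$$ where the union is over all $\Lambda\subseteq\{1,\dots,m\}$ with $\Gamma_1\setminus\{\gamma_x\}\subseteq\Lambda$, $j\notin\Lambda$ for all $j\le\gamma_x$, and $|\Lambda|\le s-1$; and the Bouligand normal cone of $F_1$ at $x$ is $$N^B_{F_1}(x)=\begin{cases}\{d\in\mathbb{R}^m:\ d_i=0\ \ \forall i\in\Gamma_1\setminus\{\gamma_x\}\}&\text{if }|\Gamma_1|=s,\\ \{d\in\mathbb{R}^m:\ d_i=0\ \ \forall i>\gamma_x\}&\text{if }|\Gamma_1|<s.\end{cases}$$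
   Context: $m,s$ are positive integers with $s<m$. For $x\in\mathbb{R}^m$, $\mathrm{supp}(x)=\{i: x_i\ne0\}$ and $\|x\|_0=|\mathrm{supp}(x)|$; for $x\neq 0$, $\gamma_x$ is the smallest index in $\mathrm{supp}(x)$. $e_i$ is the $i$-th standard basis vector. $F_1:=\{x\in\mathbb{R}^m:\ \|x\|_0\le s,\ e_{\gamma_x}^\top x=1\}$, i.e. the set of nonzero vectors with at most $s$ nonzero entries whose first nonzero entry equals $1$. Bouligand cones: for a nonempty set $S\subseteq\mathbb{R}^p$ and $x\in S$, $T^B_S(x)$ is the set of all $d\in\mathbb{R}^p$ for which there exist $\{x^k\}\subset S$ with $x^k\to x$ and $\lambda_k\ge0$ ($k\in\mathbb{N}$) such that $\lambda_k(x^k-x)\to d$; and $N^B_S(x)=\{d\in\mathbb{R}^p:\ \langle d,u\rangle\le0\ \forall u\in T^B_S(x)\}$. *)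

theory Defs
  imports "HOL-Analysis.Analysis"
begin

text \<open>
  The space \<open>\<real>\<^sup>m\<close> is rendered as \<^typ>\<open>real ^ 'm\<close> for an arbitrary finite linearly ordered index
  type \<open>'m\<close> with \<open>CARD('m) = m\<close>: such a type is order-isomorphic to \<open>{1, \<dots>, m}\<close> in exactly one
  way, so ``smallest index'' has its usual meaning.
\<close>

definition supp :: "real ^ 'm::finite \<Rightarrow> 'm set" where
  "supp x = {i. x $ i \<noteq> 0}"

definition l0norm :: "real ^ 'm::finite \<Rightarrow> nat" where
  "l0norm x = card (supp x)"

text \<open>Only meaningful for \<open>x \<noteq> 0\<close>, since \<^const>\<open>Min\<close> is unspecified on the empty set.\<close>

definition first_index :: "real ^ 'm::{finite, linorder} \<Rightarrow> 'm" where
  "first_index x = Min (supp x)"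

text \<open>The parameter \<open>s\<close>, fixed in the mathematics, is an explicit argument.\<close>

definition F1 :: "nat \<Rightarrow> (real ^ 'm::{finite, linorder}) set" where
  "F1 s = {x. x \<noteq> 0 \<and> l0norm x \<le> s \<and> axis (first_index x) 1 \<bullet> x = 1}"

definition bouligand_tangent_cone :: "'a::euclidean_space set \<Rightarrow> 'a \<Rightarrow> 'a set" where
  "bouligand_tangent_cone S x =
     {d. \<exists>X l. (\<forall>k::nat. X k \<in> S) \<and> X \<longlonglongrightarrow> x \<and> (\<forall>k. (0::real) \<le> l k) \<and>
               (\<lambda>k. l k *\<^sub>R (X k - x)) \<longlonglongrightarrow> d}"

definition bouligand_normal_cone :: "'a::euclidean_space set \<Rightarrow> 'a \<Rightarrow> 'a set" where
  "bouligand_normal_cone S x = {d. \<forall>u \<in> bouligand_tangent_cone S x. d \<bullet> u \<le> 0}"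

end

theory Submission
  imports Defs
begin

text \<open>
  Near a point \<open>x\<close> of \<open>F\<^sub>1\<close> the normalisation of the first entry becomes rigid: an entry before the
  first index of \<open>x\<close> cannot jump from \<open>0\<close> to the prescribed value \<open>1\<close>, so every nearby point of
  \<open>F\<^sub>1\<close> has the same first index as \<open>x\<close> and agrees with \<open>x\<close> up to and including it
  (\<open>eventually_agree_upto_first_index\<close>). What is left is the sparsity constraint on the later
  coordinates. Entries in the support of \<open>x\<close> stay nonzero nearby, and a direction \<open>d\<close> that is a limit
  of rescaled differences has its own support switched on as well, so the support of some point of
  \<open>F\<^sub>1\<close> contains both. Conversely, if the union of the two supports has at most \<open>s\<close> elements, then the
  whole line through \<open>x\<close> with direction \<open>d\<close> stays in \<open>F\<^sub>1\<close>. Hence (\<open>tangent_cone_F1_iff\<close>)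
  \<open>d\<close> is tangent iff it vanishes up to the first index of \<open>x\<close> and
  \<open>card (supp x \<union> supp d) \<le> s\<close>.

  Both descriptions of the tangent cone are reformulations of this criterion. For the one by lines,
  a generic point \<open>x + \<mu> d\<close> has no cancellation, so its support is exactly the union. For the one by
  spans, the relevant index set is \<open>supp x \<union> supp d\<close> without the first index.
  The normal cone follows: if \<open>x\<close> already uses all \<open>s\<close> entries, the tangent cone is a single
  coordinate subspace and the normal cone its orthogonal complement; otherwise there is room for
  one more entry, so every \<open>\<plusminus> axis i 1\<close> with \<open>i\<close> beyond the first index is tangent and forces
  the corresponding entry of a normal vector to vanish.
\<close>

section \<open>Normalised sparse vectors\<close>

lemma in_supp_iff: "i \<in> supp x \<longleftrightarrow> x $ i \<noteq> 0"
  by (simp add: supp_def)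

lemma F1D:
  fixes x :: "real ^ 'm::{finite, linorder}"
  assumes "x \<in> F1 s"
  shows "x $ first_index x = 1" and "\<And>j. j < first_index x \<Longrightarrow> x $ j = 0"
    and "card (supp x) \<le> s"
proof -
  show "x $ first_index x = 1" and "card (supp x) \<le> s"
    using assms by (auto simp: F1_def l0norm_def inner_axis')
  show "x $ j = 0" if "j < first_index x" for j
  proof (rule ccontr)
    assume "x $ j \<noteq> 0"
    then have "Min (supp x) \<le> j" by (intro Min_le) (auto simp: in_supp_iff)
    with that show False by (simp add: first_index_def)
  qed
qed

lemma first_index_eqI:
  fixes y :: "real ^ 'm::{finite, linorder}"
  assumes "y $ g \<noteq> 0" and "\<And>j. j < g \<Longrightarrow> y $ j = 0"
  shows "first_index y = g"
  unfolding first_index_def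
proof (rule Min_eqI)
  show "finite (supp y)" by simp
  show "g \<le> j" if "j \<in> supp y" for j
    using assms(2)[of j] that by (cases "j < g") (auto simp: in_supp_iff)
  show "g \<in> supp y" using assms(1) by (simp add: in_supp_iff)
qed

lemma F1I:
  fixes y :: "real ^ 'm::{finite, linorder}"
  assumes "y $ g = 1" and "\<And>j. j < g \<Longrightarrow> y $ j = 0" and "card (supp y) \<le> s"
  shows "y \<in> F1 s"
proof -
  have "first_index y = g" using assms(1,2) by (intro first_index_eqI) auto
  moreover have "y \<noteq> 0" using assms(1) by auto
  ultimately show ?thesis using assms(1,3) by (simp add: F1_def l0norm_def inner_axis')
qed

lemma F1_add_scaleR:
  fixes x :: "real ^ 'm::{finite, linorder}"
  assumes "x \<in> F1 s" and "\<forall>j \<le> first_index x. d $ j = 0" and "card (supp x \<union> supp d) \<le> s"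
  shows "x + \<mu> *\<^sub>R d \<in> F1 s"
proof (rule F1I)
  show "(x + \<mu> *\<^sub>R d) $ first_index x = 1"
    using F1D(1)[OF assms(1)] assms(2) by simp
  show "(x + \<mu> *\<^sub>R d) $ j = 0" if "j < first_index x" for j
    using F1D(2)[OF assms(1) that] assms(2) that by simp
  have "supp (x + \<mu> *\<^sub>R d) \<subseteq> supp x \<union> supp d" by (auto simp: supp_def)
  then have "card (supp (x + \<mu> *\<^sub>R d)) \<le> card (supp x \<union> supp d)" by (intro card_mono) auto
  then show "card (supp (x + \<mu> *\<^sub>R d)) \<le> s" using assms(3) by linarith
qed

text \<open>
  Each coordinate where \<open>x\<close> or \<open>d\<close> is nonzero cancels for at most one value of the parameter, so only
  finitely many values are bad.
\<close>
lemma generic_supp_add_scaleR: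
  fixes x d :: "real ^ 'm::finite"
  shows "\<exists>\<mu>. supp (x + \<mu> *\<^sub>R d) = supp x \<union> supp d"
proof -
  have "finite (insert 0 (range (\<lambda>i. - x $ i / d $ i)))" by simp
  then obtain \<mu> :: real where \<mu>: "\<mu> \<notin> insert 0 (range (\<lambda>i. - x $ i / d $ i))"
    using ex_new_if_finite[OF infinite_UNIV_char_0] by blast
  have "x $ i + \<mu> * d $ i \<noteq> 0" if "x $ i \<noteq> 0 \<or> d $ i \<noteq> 0" for i
  proof (cases "d $ i = 0")
    case False
    have "\<mu> \<noteq> - x $ i / d $ i" using \<mu> by auto
    with False show ?thesis by (auto simp: field_simps add_eq_0_iff)
  qed (use that in simp)
  then have "supp (x + \<mu> *\<^sub>R d) = supp x \<union> supp d" by (auto simp: supp_def)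
  then show ?thesis ..
qed

section \<open>Tangent directions\<close>

text \<open>
  Close to \<open>x\<close> the entry at the first index of \<open>x\<close> stays nonzero, so the first index cannot grow;
  it cannot shrink either, because an earlier first entry would equal \<open>1\<close> while converging to \<open>0\<close>.
\<close>
lemma eventually_agree_upto_first_index:
  fixes x :: "real ^ 'm::{finite, linorder}"
  assumes x: "x \<in> F1 s" and X: "\<And>k. X k \<in> F1 s" and lim: "X \<longlonglongrightarrow> x"
  shows "\<forall>\<^sub>F k in sequentially. \<forall>j \<le> first_index x. X k $ j = x $ j"
proof -
  let ?g = "first_index x"
  have entry: "(\<lambda>k. X k $ j) \<longlonglongrightarrow> x $ j" for j
    using lim by (rule tendsto_vec_nth)
  have "\<forall>\<^sub>F k in sequentially. X k $ ?g \<noteq> 0"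
    using tendsto_imp_eventually_ne[OF entry] F1D(1)[OF x] by simp
  moreover have "\<forall>\<^sub>F k in sequentially. \<forall>j. j < ?g \<longrightarrow> X k $ j \<noteq> 1"
  proof (rule eventually_all_finite)
    fix j
    show "\<forall>\<^sub>F k in sequentially. j < ?g \<longrightarrow> X k $ j \<noteq> 1"
    proof (cases "j < ?g")
      case True
      then have "x $ j \<noteq> 1" using F1D(2)[OF x] by simp
      then show ?thesis using tendsto_imp_eventually_ne[OF entry] by (auto elim: eventually_mono)
    qed simp
  qed
  ultimately show ?thesis
  proof eventually_elim
    case (elim k)
    have "\<not> ?g < first_index (X k)" using F1D(2)[OF X] elim(1) by blast
    moreover have "\<not> first_index (X k) < ?g" using F1D(1)[OF X] elim(2) by blast
    ultimately have eq: "first_index (X k) = ?g" by simp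
    show ?case
    proof (intro allI impI)
      fix j assume "j \<le> ?g"
      then consider "j < ?g" | "j = ?g" by fastforce
      then show "X k $ j = x $ j"
        by cases (use F1D(1,2)[OF X[of k]] F1D(1,2)[OF x] eq in auto)
    qed
  qed
qed

text \<open>
  For a coordinate outside the support of \<open>x\<close>, a nonzero limit of the rescaled entries needs those
  entries to be nonzero themselves; so far along the sequence the support of \<open>X k\<close> contains that of
  \<open>d\<close> as well as that of \<open>x\<close>.
\<close>
lemma eventually_supp_Un_subset:
  fixes x d :: "real ^ 'm::finite"
  assumes lim: "X \<longlonglongrightarrow> x" and dir: "(\<lambda>k. l k *\<^sub>R (X k - x)) \<longlonglongrightarrow> d"
  shows "\<forall>\<^sub>F k in sequentially. supp x \<union> supp d \<subseteq> supp (X k)"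
proof -
  have "\<forall>\<^sub>F k in sequentially. \<forall>i. i \<in> supp x \<union> supp d \<longrightarrow> X k $ i \<noteq> 0"
  proof (rule eventually_all_finite)
    fix i
    show "\<forall>\<^sub>F k in sequentially. i \<in> supp x \<union> supp d \<longrightarrow> X k $ i \<noteq> 0"
    proof (cases "x $ i = 0")
      case False
      then have "\<forall>\<^sub>F k in sequentially. X k $ i \<noteq> 0"
        using tendsto_imp_eventually_ne[OF tendsto_vec_nth[OF lim]] by blast
      then show ?thesis by (rule eventually_mono) simp
    next
      case True
      show ?thesis
      proof (cases "d $ i = 0")
        case False
        then have "\<forall>\<^sub>F k in sequentially. (l k *\<^sub>R (X k - x)) $ i \<noteq> 0"
          using tendsto_imp_eventually_ne[OF tendsto_vec_nth[OF dir]] by blast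
        then show ?thesis using True by (auto elim!: eventually_mono)
      qed (use True in \<open>simp add: in_supp_iff\<close>)
    qed
  qed
  then show ?thesis by (rule eventually_mono) (auto simp: in_supp_iff)
qed

lemma bouligand_tangent_coneI_ray:
  assumes "\<And>\<mu>::real. 0 < \<mu> \<Longrightarrow> x + \<mu> *\<^sub>R d \<in> S"
  shows "d \<in> bouligand_tangent_cone S x"
proof -
  let ?X = "\<lambda>k::nat. x + inverse (real (Suc k)) *\<^sub>R d"
  have "?X \<longlonglongrightarrow> x + 0 *\<^sub>R d"
    by (intro tendsto_intros LIMSEQ_inverse_real_of_nat)
  moreover have "(\<lambda>k. real (Suc k) *\<^sub>R (?X k - x)) \<longlonglongrightarrow> d"
    by simp
  moreover have "?X k \<in> S" for k
    by (rule assms) simp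
  ultimately show ?thesis
    unfolding bouligand_tangent_cone_def
    by (intro CollectI exI[of _ ?X] exI[of _ "\<lambda>k. real (Suc k)"]) simp
qed

lemma tangent_cone_F1_iff:
  fixes x :: "real ^ 'm::{finite, linorder}"
  assumes x: "x \<in> F1 s"
  shows "d \<in> bouligand_tangent_cone (F1 s) x \<longleftrightarrow>
    (\<forall>j \<le> first_index x. d $ j = 0) \<and> card (supp x \<union> supp d) \<le> s"
proof
  assume "d \<in> bouligand_tangent_cone (F1 s) x"
  then obtain X l where X: "\<And>k. X k \<in> F1 s" and lim: "X \<longlonglongrightarrow> x"
    and dir: "(\<lambda>k. l k *\<^sub>R (X k - x)) \<longlonglongrightarrow> d"
    unfolding bouligand_tangent_cone_def by blast
  have "d $ j = 0" if "j \<le> first_index x" for j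
  proof -
    have "\<forall>\<^sub>F k in sequentially. (l k *\<^sub>R (X k - x)) $ j = 0"
      using eventually_agree_upto_first_index[OF x X lim]
      by (rule eventually_mono) (use that in simp)
    then have "(\<lambda>k. (l k *\<^sub>R (X k - x)) $ j) \<longlonglongrightarrow> 0"
      by (rule tendsto_eventually)
    then show ?thesis
      using tendsto_vec_nth[OF dir] LIMSEQ_unique by blast
  qed
  moreover obtain k where "supp x \<union> supp d \<subseteq> supp (X k)"
    using eventually_happens[OF eventually_supp_Un_subset[OF lim dir]] by auto
  then have "card (supp x \<union> supp d) \<le> card (supp (X k))" by (intro card_mono) auto
  then have "card (supp x \<union> supp d) \<le> s" using F1D(3)[OF X[of k]] by linarith
  ultimately show "(\<forall>j \<le> first_index x. d $ j = 0) \<and> card (supp x \<union> supp d) \<le> s" by blast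
next
  assume "(\<forall>j \<le> first_index x. d $ j = 0) \<and> card (supp x \<union> supp d) \<le> s"
  then show "d \<in> bouligand_tangent_cone (F1 s) x"
    using x by (intro bouligand_tangent_coneI_ray F1_add_scaleR) auto
qed

section \<open>Two descriptions of the tangent cone\<close>

lemma span_axis_image_iff:
  fixes d :: "real ^ 'm::finite"
  shows "d \<in> span ((\<lambda>i. axis i 1) ` \<Lambda>) \<longleftrightarrow> supp d \<subseteq> \<Lambda>"
proof -
  have "(\<lambda>i. axis i 1 :: real ^ 'm) ` \<Lambda> \<subseteq> Basis" by (auto simp: Basis_vec_def)
  then have "span ((\<lambda>i. axis i 1 :: real ^ 'm) ` \<Lambda>) =
      {v. \<forall>b\<in>Basis. b \<notin> (\<lambda>i. axis i 1) ` \<Lambda> \<longrightarrow> v \<bullet> b = 0}"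
    by (rule span_substd_basis)
  then show ?thesis
    by (auto simp: Basis_vec_def axis_eq_axis image_iff inner_axis in_supp_iff subset_iff)
qed

text \<open>The entry \<open>1\<close> of \<open>x\<close> at its first index uses up one of the \<open>s\<close> places in the support;
  this is the source of the bound \<open>s - 1\<close> for tangent directions.\<close>
lemma card_supp_Un_remove_first_index:
  fixes x :: "real ^ 'm::{finite, linorder}"
  assumes "x \<in> F1 s"
  shows "card (supp x \<union> supp d) = Suc (card ((supp x \<union> supp d) - {first_index x}))"
proof -
  have "first_index x \<in> supp x \<union> supp d" using F1D(1)[OF assms] by (simp add: in_supp_iff)
  then show ?thesis by (metis card_Suc_Diff1 finite)
qed

lemma tangent_cone_F1_lines:
  fixes x :: "real ^ 'm::{finite, linorder}"
  assumes x: "x \<in> F1 s"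
  shows "bouligand_tangent_cone (F1 s) x =
    {d. l0norm d \<le> s - 1 \<and> (\<forall>j \<le> first_index x. d $ j = 0) \<and> (\<forall>\<mu>::real. x + \<mu> *\<^sub>R d \<in> F1 s)}"
    (is "_ = ?R")
proof (intro set_eqI iffI)
  fix d assume "d \<in> bouligand_tangent_cone (F1 s) x"
  then have d0: "\<forall>j \<le> first_index x. d $ j = 0" and c: "card (supp x \<union> supp d) \<le> s"
    using tangent_cone_F1_iff[OF x] by auto
  have "supp d \<subseteq> (supp x \<union> supp d) - {first_index x}" using d0 by (auto simp: in_supp_iff)
  then have "card (supp d) \<le> card ((supp x \<union> supp d) - {first_index x})"
    by (intro card_mono) auto
  then have "l0norm d \<le> s - 1"
    using c card_supp_Un_remove_first_index[OF x, of d] by (simp add: l0norm_def)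
  then show "d \<in> ?R" using d0 F1_add_scaleR[OF x d0 c] by simp
next
  fix d assume d: "d \<in> ?R"
  obtain \<mu> where \<mu>: "supp (x + \<mu> *\<^sub>R d) = supp x \<union> supp d"
    using generic_supp_add_scaleR by blast
  have "x + \<mu> *\<^sub>R d \<in> F1 s" using d by blast
  then have "card (supp x \<union> supp d) \<le> s" using F1D(3) \<mu> by metis
  then show "d \<in> bouligand_tangent_cone (F1 s) x"
    using d tangent_cone_F1_iff[OF x] by blast
qed

lemma tangent_cone_F1_spans:
  fixes x :: "real ^ 'm::{finite, linorder}"
  assumes s: "1 \<le> s" and x: "x \<in> F1 s"
  shows "bouligand_tangent_cone (F1 s) x =
    (\<Union>\<Lambda> \<in> {\<Lambda>. supp x - {first_index x} \<subseteq> \<Lambda> \<and> (\<forall>j \<le> first_index x. j \<notin> \<Lambda>) \<and> card \<Lambda> \<le> s - 1}.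
      span ((\<lambda>i. axis i 1) ` \<Lambda>))" (is "_ = ?R")
proof (intro set_eqI iffI)
  fix d assume "d \<in> bouligand_tangent_cone (F1 s) x"
  then have d0: "\<forall>j \<le> first_index x. d $ j = 0" and c: "card (supp x \<union> supp d) \<le> s"
    using tangent_cone_F1_iff[OF x] by auto
  let ?L = "(supp x \<union> supp d) - {first_index x}"
  have "card ?L \<le> s - 1" using c card_supp_Un_remove_first_index[OF x, of d] by simp
  moreover have "\<forall>j \<le> first_index x. j \<notin> ?L"
    using d0 F1D(2)[OF x] by (auto simp: in_supp_iff order_le_less)
  moreover have "supp d \<subseteq> ?L" using d0 by (auto simp: in_supp_iff)
  then have "d \<in> span ((\<lambda>i. axis i 1) ` ?L)" by (simp only: span_axis_image_iff)
  ultimately show "d \<in> ?R" by (intro UN_I[of ?L]) auto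
next
  fix d assume "d \<in> ?R"
  then obtain \<Lambda> where L: "supp x - {first_index x} \<subseteq> \<Lambda>" "\<forall>j \<le> first_index x. j \<notin> \<Lambda>"
      "card \<Lambda> \<le> s - 1" and d: "supp d \<subseteq> \<Lambda>"
    by (auto simp: span_axis_image_iff)
  have "(supp x \<union> supp d) - {first_index x} \<subseteq> \<Lambda>" using L(1) d by blast
  then have "card ((supp x \<union> supp d) - {first_index x}) \<le> card \<Lambda>" by (intro card_mono) auto
  then have "card (supp x \<union> supp d) \<le> s"
    using card_supp_Un_remove_first_index[OF x, of d] L(3) s by linarith
  moreover have "\<forall>j \<le> first_index x. d $ j = 0" using L(2) d by (auto simp: supp_def)
  ultimately show "d \<in> bouligand_tangent_cone (F1 s) x" using tangent_cone_F1_iff[OF x] by blast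
qed

section \<open>The normal cone\<close>

lemma normal_cone_entry_eq_0:
  fixes d :: "real ^ 'm::finite"
  assumes "d \<in> bouligand_normal_cone S x"
    and "\<And>c::real. c *\<^sub>R axis i 1 \<in> bouligand_tangent_cone S x"
  shows "d $ i = 0"
proof -
  have "d \<bullet> (d $ i *\<^sub>R axis i 1) \<le> 0" using assms unfolding bouligand_normal_cone_def by blast
  then have "d $ i * d $ i \<le> 0" by (simp add: inner_axis)
  then show ?thesis by (metis mult_eq_0_iff order_antisym zero_le_square)
qed

lemma inner_eq_0_disjoint_supp:
  fixes d u :: "real ^ 'm::finite"
  assumes "\<And>i. i \<in> supp u \<Longrightarrow> d $ i = 0"
  shows "d \<bullet> u = 0"
  unfolding inner_vec_def using assms by (intro sum.neutral) (auto simp: in_supp_iff)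

text \<open>The tangent cone need not be convex, but to compute its polar it is enough to know which
  coordinate axes it contains, provided that no tangent vector leaves their span.\<close>
lemma normal_cone_coordinatewise:
  fixes S :: "(real ^ 'm::finite) set"
  assumes "\<And>i c. i \<in> I \<Longrightarrow> c *\<^sub>R axis i 1 \<in> bouligand_tangent_cone S x"
    and "\<And>u. u \<in> bouligand_tangent_cone S x \<Longrightarrow> supp u \<subseteq> I"
  shows "bouligand_normal_cone S x = {d. \<forall>i \<in> I. d $ i = 0}"
proof (intro set_eqI iffI)
  fix d assume "d \<in> bouligand_normal_cone S x"
  then show "d \<in> {d. \<forall>i \<in> I. d $ i = 0}" using normal_cone_entry_eq_0 assms(1) by blast
next
  fix d :: "real ^ 'm" assume d: "d \<in> {d. \<forall>i \<in> I. d $ i = 0}"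
  have "d \<bullet> u = 0" if "u \<in> bouligand_tangent_cone S x" for u
    using inner_eq_0_disjoint_supp d assms(2)[OF that] by blast
  then show "d \<in> bouligand_normal_cone S x" by (simp add: bouligand_normal_cone_def)
qed

lemma axis_in_tangent_cone_F1:
  fixes x :: "real ^ 'm::{finite, linorder}"
  assumes "x \<in> F1 s" and "first_index x < i" and "card (insert i (supp x)) \<le> s"
  shows "c *\<^sub>R axis i 1 \<in> bouligand_tangent_cone (F1 s) x"
proof -
  have "supp x \<union> supp (c *\<^sub>R axis i 1) \<subseteq> insert i (supp x)" by (auto simp: supp_def axis_def)
  then have "card (supp x \<union> supp (c *\<^sub>R axis i 1)) \<le> card (insert i (supp x))"
    by (intro card_mono) auto
  then have "card (supp x \<union> supp (c *\<^sub>R axis i 1)) \<le> s" using assms(3) by linarith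
  moreover have "\<forall>j \<le> first_index x. (c *\<^sub>R axis i 1) $ j = 0" using assms(2) by (auto simp: axis_def)
  ultimately show ?thesis using tangent_cone_F1_iff[OF assms(1)] by blast
qed

lemma normal_cone_F1_full_support:
  fixes x :: "real ^ 'm::{finite, linorder}"
  assumes x: "x \<in> F1 s" and full: "card (supp x) = s"
  shows "bouligand_normal_cone (F1 s) x = {d. \<forall>i \<in> supp x - {first_index x}. d $ i = 0}"
proof (rule normal_cone_coordinatewise)
  fix i c assume i: "i \<in> supp x - {first_index x}"
  then have "first_index x < i" using F1D(2)[OF x, of i] by (auto simp: in_supp_iff neq_iff)
  moreover have "insert i (supp x) = supp x" using i by blast
  ultimately show "c *\<^sub>R axis i 1 \<in> bouligand_tangent_cone (F1 s) x"
    using full by (intro axis_in_tangent_cone_F1 x) auto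
next
  fix u assume "u \<in> bouligand_tangent_cone (F1 s) x"
  then have u0: "\<forall>j \<le> first_index x. u $ j = 0" and c: "card (supp x \<union> supp u) \<le> s"
    using tangent_cone_F1_iff[OF x] by auto
  have "supp x = supp x \<union> supp u" using c full by (intro card_seteq) auto
  then show "supp u \<subseteq> supp x - {first_index x}" using u0 by (auto simp: in_supp_iff)
qed

lemma normal_cone_F1_deficient_support:
  fixes x :: "real ^ 'm::{finite, linorder}"
  assumes x: "x \<in> F1 s" and less: "card (supp x) < s"
  shows "bouligand_normal_cone (F1 s) x = {d. \<forall>i > first_index x. d $ i = 0}"
proof -
  have "bouligand_normal_cone (F1 s) x = {d. \<forall>i \<in> {first_index x<..}. d $ i = 0}"
  proof (rule normal_cone_coordinatewise)
    fix i c assume "i \<in> {first_index x<..}"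
    moreover have "card (insert i (supp x)) \<le> s" using less by (simp add: card_insert_if)
    ultimately show "c *\<^sub>R axis i 1 \<in> bouligand_tangent_cone (F1 s) x"
      by (intro axis_in_tangent_cone_F1 x) auto
  next
    fix u assume "u \<in> bouligand_tangent_cone (F1 s) x"
    then have "\<forall>j \<le> first_index x. u $ j = 0" using tangent_cone_F1_iff[OF x] by blast
    then show "supp u \<subseteq> {first_index x<..}" by (auto simp: in_supp_iff not_le[symmetric])
  qed
  then show ?thesis by (simp add: Ball_def)
qed

theorem theorem3p1:
  fixes s :: nat and x :: "real ^ 'm::{finite, linorder}"
  assumes "1 \<le> s" and "s < CARD('m)" and "x \<in> F1 s"
  shows "bouligand_tangent_cone (F1 s) x =
           {d. l0norm d \<le> s - 1 \<and> (\<forall>j \<le> first_index x. d $ j = 0) \<and>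
               (\<forall>\<mu>::real. x + \<mu> *\<^sub>R d \<in> F1 s)}
       \<and> bouligand_tangent_cone (F1 s) x =
           (\<Union>\<Lambda> \<in> {\<Lambda>. supp x - {first_index x} \<subseteq> \<Lambda> \<and> (\<forall>j \<le> first_index x. j \<notin> \<Lambda>) \<and>
                      card \<Lambda> \<le> s - 1}.
              span ((\<lambda>i. axis i 1) ` \<Lambda>))
       \<and> (card (supp x) = s \<longrightarrow>
           bouligand_normal_cone (F1 s) x = {d. \<forall>i \<in> supp x - {first_index x}. d $ i = 0})
       \<and> (card (supp x) < s \<longrightarrow>
           bouligand_normal_cone (F1 s) x = {d. \<forall>i > first_index x. d $ i = 0})"
  using tangent_cone_F1_lines[OF assms(3)] tangent_cone_F1_spans[OF assms(1,3)]
    normal_cone_F1_full_support[OF assms(3)] normal_cone_F1_deficient_support[OF assms(3)]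
  by (intro conjI impI)

end
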